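(* Let $M$ be a transversal matroid of rank $r$ on $E$, and let $\mathcal{A}=(A_i:i\in[r])$ and $\mathcal{B}=(B_i:i\in[r])$ be presentations of $M$. (1) If $\mathcal{A}$ is a maximal presentation, then $s_\mathcal{A}(X)\in L_\mathcal{A}$ for all $X\subseteq E$. (2) Assume $\mathcal{A}\prec\mathcal{B}$. For $X\subseteq E$, if $s_\mathcal{A}(X)\neq s_\mathcal{B}(X)$, then $s_\mathcal{A}(X)\notin L_\mathcal{B}$.
   Context: $[r]=\{1,\dots,r\}$. For a set system $\mathcal{A}=(A_i:i\in[r])$ on a finite set $E$, $M[\mathcal{A}]$ is the transversal matroid on $E$ whose independent sets are the partial transversals of $\mathcal{A}$; $\mathcal{A}$ is a presentation of $M[\mathcal{A}]$, and presentations of a rank-$r$ matroid are taken to have exactly $r$ sets. Presentations of $M$ are ordered by $\mathcal{A}\preceq\mathcal{B}$ iff $A_i\subseteq B_i$ for all $i$; $\mathcal{A}\prec\mathcal{B}$ means $\mathcal{A}\preceq\mathcal{B}$ with at least one inclusion strict; maximal means maximal in this order. $s_\mathcal{A}(X)=\{i: X\cap A_i\neq\emptyset\}$. Fix $x\notin E$; for $I\subseteq[r]$, $\mathcal{A}^I$ is obtained from $\mathcal{A}$ by replacing $A_i$ by $A_i\cup\{x\}$ for each $i\in I$. Let $\sigma_\mathcal{A}(I)=I\cup\{k\in[r]-I: x\text{ is a coloop of } M[\mathcal{A}^I]\backslash A_k\}$; $L_\mathcal{A}$ is the set of $I\subseteq[r]$ with $\sigma_\mathcal{A}(I)=I$;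 similarly $L_\mathcal{B}$. *)

theory Defs
  imports Main
begin

record 'a pre_matroid =
  ground :: "'a set"
  indeps :: "'a set set"

definition is_matroid :: "'a pre_matroid \<Rightarrow> bool" where
  "is_matroid M \<longleftrightarrow>
     finite (ground M) \<and>
     (\<forall>X\<in>indeps M. X \<subseteq> ground M) \<and>
     {} \<in> indeps M \<and>
     (\<forall>X Y. Y \<in> indeps M \<and> X \<subseteq> Y \<longrightarrow> X \<in> indeps M) \<and>
     (\<forall>X\<in>indeps M. \<forall>Y\<in>indeps M. card X < card Y \<longrightarrow> (\<exists>y\<in>Y - X. insert y X \<in> indeps M))"

definition basis :: "'a pre_matroid \<Rightarrow> 'a set \<Rightarrow> bool" where
  "basis M B \<longleftrightarrow> B \<in> indeps M \<and> (\<forall>X\<in>indeps M. B \<subseteq> X \<longrightarrow> X = B)"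

definition rank :: "'a pre_matroid \<Rightarrow> nat" where
  "rank M = Max (card ` indeps M)"

definition coloop :: "'a pre_matroid \<Rightarrow> 'a \<Rightarrow> bool" where
  "coloop M e \<longleftrightarrow> e \<in> ground M \<and> (\<forall>B. basis M B \<longrightarrow> e \<in> B)"

definition deletion :: "'a pre_matroid \<Rightarrow> 'a set \<Rightarrow> 'a pre_matroid" where
  "deletion M X = \<lparr> ground = ground M - X, indeps = {Y \<in> indeps M. Y \<inter> X = {}} \<rparr>"

text \<open>A set system \<open>(A\<^sub>i : i \<in> [r])\<close> is encoded by a function on \<^typ>\<open>nat\<close> of which only
  the values on \<open>{1..r}\<close> are relevant.\<close>

definition set_system :: "'a set \<Rightarrow> nat \<Rightarrow> (nat \<Rightarrow> 'a set) \<Rightarrow> bool" where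
  "set_system E r A \<longleftrightarrow> (\<forall>i\<in>{1..r}. A i \<subseteq> E)"

definition partial_transversal :: "nat \<Rightarrow> (nat \<Rightarrow> 'a set) \<Rightarrow> 'a set \<Rightarrow> bool" where
  "partial_transversal r A X \<longleftrightarrow>
     (\<exists>f. inj_on f X \<and> (\<forall>e\<in>X. f e \<in> {1..r} \<and> e \<in> A (f e)))"

definition matroid_of :: "'a set \<Rightarrow> nat \<Rightarrow> (nat \<Rightarrow> 'a set) \<Rightarrow> 'a pre_matroid" where
  "matroid_of E r A = \<lparr> ground = E, indeps = {X. X \<subseteq> E \<and> partial_transversal r A X} \<rparr>"

definition transversal_matroid :: "'a pre_matroid \<Rightarrow> bool" where
  "transversal_matroid M \<longleftrightarrow>
     is_matroid M \<and> (\<exists>r A. set_system (ground M) r A \<and> M = matroid_of (ground M) r A)"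

definition presentation :: "'a pre_matroid \<Rightarrow> (nat \<Rightarrow> 'a set) \<Rightarrow> bool" where
  "presentation M A \<longleftrightarrow>
     set_system (ground M) (rank M) A \<and> matroid_of (ground M) (rank M) A = M"

definition pres_le :: "nat \<Rightarrow> (nat \<Rightarrow> 'a set) \<Rightarrow> (nat \<Rightarrow> 'a set) \<Rightarrow> bool" where
  "pres_le r A B \<longleftrightarrow> (\<forall>i\<in>{1..r}. A i \<subseteq> B i)"

definition pres_less :: "nat \<Rightarrow> (nat \<Rightarrow> 'a set) \<Rightarrow> (nat \<Rightarrow> 'a set) \<Rightarrow> bool" where
  "pres_less r A B \<longleftrightarrow> pres_le r A B \<and> (\<exists>i\<in>{1..r}. A i \<subset> B i)"

definition maximal_presentation :: "'a pre_matroid \<Rightarrow> (nat \<Rightarrow> 'a set) \<Rightarrow> bool" where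
  "maximal_presentation M A \<longleftrightarrow>
     presentation M A \<and> \<not> (\<exists>B. presentation M B \<and> pres_less (rank M) A B)"

definition supp :: "nat \<Rightarrow> (nat \<Rightarrow> 'a set) \<Rightarrow> 'a set \<Rightarrow> nat set" where
  "supp r A X = {i\<in>{1..r}. X \<inter> A i \<noteq> {}}"

definition ext :: "(nat \<Rightarrow> 'a set) \<Rightarrow> 'a \<Rightarrow> nat set \<Rightarrow> nat \<Rightarrow> 'a set" where
  "ext A x I = (\<lambda>i. if i \<in> I then insert x (A i) else A i)"

text \<open>The matroid of the extended system lives on \<open>insert x E\<close> for every \<open>I\<close>; in particular
  \<open>x\<close> is a loop of it when \<open>I\<close> is empty.\<close>

definition sigma :: "'a set \<Rightarrow> nat \<Rightarrow> 'a \<Rightarrow> (nat \<Rightarrow> 'a set) \<Rightarrow> nat set \<Rightarrow> nat set" where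
  "sigma E r x A I =
     I \<union> {k \<in> {1..r} - I. coloop (deletion (matroid_of (insert x E) r (ext A x I)) (A k)) x}"

definition L :: "'a set \<Rightarrow> nat \<Rightarrow> 'a \<Rightarrow> (nat \<Rightarrow> 'a set) \<Rightarrow> nat set set" where
  "L E r x A = {I. I \<subseteq> {1..r} \<and> sigma E r x A I = I}"

text \<open>The partial transversals of a set system do form a matroid, so the conjunct
  \<^const>\<open>is_matroid\<close> in \<^const>\<open>transversal_matroid\<close> only requires the ground set to be finite.\<close>

lemma partial_transversal_augment:
  assumes "finite X" "finite Y" "card X < card Y"
    and "inj_on f X" "\<forall>e\<in>X. f e \<in> {1..r} \<and> e \<in> A (f e)"
    and g: "inj_on g Y" "\<forall>e\<in>Y. g e \<in> {1..r} \<and> e \<in> A (g e)"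
  shows "\<exists>y\<in>Y - X. partial_transversal r A (insert y X)"
  using assms(4,5)
proof (induction "card {z\<in>X \<inter> Y. f z \<noteq> g z}" arbitrary: f rule: less_induct)
  case less
  have "card (f ` X) < card (g ` Y)"
    using assms(3) g(1) less.prems(1) by (simp add: card_image)
  then have "\<not> g ` Y \<subseteq> f ` X"
    using assms(1) by (metis card_mono finite_imageI not_le)
  then obtain y where y: "y \<in> Y" "g y \<notin> f ` X" by blast
  let ?f = "f(y := g y)"
  have inj: "inj_on ?f (insert y X)"
  proof (rule inj_onI)
    fix a b assume ab: "a \<in> insert y X" "b \<in> insert y X" "?f a = ?f b"
    have "f c \<noteq> g y" if "c \<in> X" for c using that y(2) by (metis imageI)
    with ab show "a = b"
      using less.prems(1) by (cases "a = y"; cases "b = y") (auto dest: inj_onD)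
  qed
  have val: "\<forall>e\<in>insert y X. ?f e \<in> {1..r} \<and> e \<in> A (?f e)"
    using less.prems(2) g(2) y(1) by auto
  show ?case
  proof (cases "y \<in> X")
    case False
    then show ?thesis
      using y(1) inj val unfolding partial_transversal_def by blast
  next
    case True
    have "{z\<in>X \<inter> Y. ?f z \<noteq> g z} \<subset> {z\<in>X \<inter> Y. f z \<noteq> g z}"
      using True y by force
    then have "card {z\<in>X \<inter> Y. ?f z \<noteq> g z} < card {z\<in>X \<inter> Y. f z \<noteq> g z}"
      using assms(1) by (intro psubset_card_mono) auto
    moreover have "insert y X = X" using True by blast
    ultimately show ?thesis
      using less.hyps[of ?f] inj val by simp
  qed
qed

lemma is_matroid_matroid_of:
  assumes "finite E"
  shows "is_matroid (matroid_of E r A)"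
proof -
  have "partial_transversal r A X" if sub: "partial_transversal r A Y" "X \<subseteq> Y" for X Y
  proof -
    from sub(1) obtain f where "inj_on f Y" "\<forall>e\<in>Y. f e \<in> {1..r} \<and> e \<in> A (f e)"
      unfolding partial_transversal_def by blast
    with sub(2) have "inj_on f X" "\<forall>e\<in>X. f e \<in> {1..r} \<and> e \<in> A (f e)"
      by (auto intro: inj_on_subset)
    then show ?thesis unfolding partial_transversal_def by blast
  qed
  moreover have "\<exists>y\<in>Y - X. insert y X \<subseteq> E \<and> partial_transversal r A (insert y X)"
    if aug: "X \<subseteq> E" "Y \<subseteq> E" "partial_transversal r A X" "partial_transversal r A Y" "card X < card Y"
    for X Y
  proof -
    have fin: "finite X" "finite Y"
      using aug(1,2) assms finite_subset by blast+
    obtain f g where "inj_on f X" "\<forall>e\<in>X. f e \<in> {1..r} \<and> e \<in> A (f e)"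
      "inj_on g Y" "\<forall>e\<in>Y. g e \<in> {1..r} \<and> e \<in> A (g e)"
      using aug(3,4) unfolding partial_transversal_def by blast
    from partial_transversal_augment[OF fin aug(5) this] show ?thesis
      using aug(1,2) by blast
  qed
  moreover have "partial_transversal r A {}"
    by (simp add: partial_transversal_def)
  ultimately show ?thesis
    using assms unfolding is_matroid_def matroid_of_def pre_matroid.simps mem_Collect_eq
    by (intro conjI ballI allI impI) (blast | simp)+
qed

end

theory Submission
  imports Defs
begin

text \<open>If a set \<open>S\<close> is matched by \<open>g\<close> and \<open>S \<union> {z}\<close> is a partial transversal, then \<open>S \<union> {z}\<close> has a
  matching that uses all of \<open>g ` S\<close> and just one further index.  So if \<open>e\<close> can be added to \<open>S\<close>
  at two different free indices, one of them stays free and \<open>S \<union> {z, e}\<close> is a partial transversal.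

  Part (1): let \<open>I = s\<^sub>A(X)\<close>, \<open>k \<notin> I\<close>, and suppose \<open>x\<close> is a coloop of \<open>M[A\<^sup>I] \ A\<^sub>k\<close>.  A matching of
  \<open>T \<union> {x}\<close>, with \<open>T\<close> a basis of \<open>M \ A\<^sub>k\<close>, sends \<open>x\<close> to some \<open>i \<in> I\<close>; pick \<open>y \<in> X \<inter> A\<^sub>i\<close>.  Then
  \<open>y \<in> T\<close>, and \<open>y\<close> can be matched both to its own index and to the free index \<open>i\<close>, so by the above \<open>y\<close> is
  a coloop of \<open>M \ A\<^sub>k\<close>.  Hence \<open>y\<close> can be added to \<open>A\<^sub>k\<close> without changing \<open>M\<close>, against maximality.

  Part (2): take \<open>y \<in> X \<inter> B\<^sub>k\<close> with \<open>k \<notin> s\<^sub>A(X)\<close>.  For \<open>T\<close> independent and disjoint from \<open>B\<^sub>k\<close>, the set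
  \<open>T \<union> {y}\<close> is independent because \<open>y\<close> can be matched to \<open>k\<close>; a matching of it in \<open>A\<close> sends \<open>y\<close> into
  \<open>s\<^sub>A(X)\<close>, so \<open>x\<close> can take the place of \<open>y\<close>, and \<open>x\<close> is a coloop after deleting \<open>B\<^sub>k\<close>.\<close>

section \<open>Matchings that witness partial transversals\<close>

definition matches :: "nat \<Rightarrow> (nat \<Rightarrow> 'a set) \<Rightarrow> ('a \<Rightarrow> nat) \<Rightarrow> 'a set \<Rightarrow> bool" where
  "matches r A f X \<longleftrightarrow> inj_on f X \<and> (\<forall>e\<in>X. f e \<in> {1..r} \<and> e \<in> A (f e))"

lemma partial_transversal_iff_matches: "partial_transversal r A X \<longleftrightarrow> (\<exists>f. matches r A f X)"
  by (simp add: partial_transversal_def matches_def)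

lemma matches_subset: "matches r A f Y \<Longrightarrow> X \<subseteq> Y \<Longrightarrow> matches r A f X"
  by (auto simp: matches_def intro: inj_on_subset)

text \<open>The comparison of sets is required only on elements of \<open>X\<close>, so a matching
  of a set avoiding \<open>x\<close> also passes from \<open>ext A x I\<close> back to
  \<open>A\<close>.\<close>

lemma matches_mono:
  assumes "matches r A f X" and "\<And>e i. e \<in> X \<Longrightarrow> i \<in> {1..r} \<Longrightarrow> e \<in> A i \<Longrightarrow> e \<in> B i"
  shows "matches r B f X"
  using assms by (auto simp: matches_def)

lemma partial_transversal_subset:
  "partial_transversal r A Y \<Longrightarrow> X \<subseteq> Y \<Longrightarrow> partial_transversal r A X"
  by (meson partial_transversal_iff_matches matches_subset)

lemma partial_transversal_mono:
  assumes "partial_transversal r A X"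
    and "\<And>e i. e \<in> X \<Longrightarrow> i \<in> {1..r} \<Longrightarrow> e \<in> A i \<Longrightarrow> e \<in> B i"
  shows "partial_transversal r B X"
  using assms matches_mono unfolding partial_transversal_iff_matches by metis

text \<open>This covers \<open>e \<in> X\<close> too: then \<open>e\<close> is moved from its old
  index to the free index \<open>i\<close>.\<close>

lemma matches_insert:
  assumes "matches r A f X" "i \<in> {1..r}" "e \<in> A i" "i \<notin> f ` X"
  shows "matches r A (f(e := i)) (insert e X)"
  using assms unfolding matches_def inj_on_def by (auto simp: image_iff)

lemma partial_transversal_insert:
  assumes "matches r A f X" "i \<in> {1..r}" "e \<in> A i" "i \<notin> f ` X"
  shows "partial_transversal r A (insert e X)"
  using matches_insert[OF assms] partial_transversal_iff_matches by blast

lemma partial_transversal_insert_of_card_less: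
  assumes "finite X" "finite Y" "card X < card Y"
    and "partial_transversal r A X" "partial_transversal r A Y"
  obtains y where "y \<in> Y - X" "partial_transversal r A (insert y X)"
  using assms partial_transversal_augment[of X Y]
  unfolding partial_transversal_def by metis

section \<open>Comparing two matchings\<close>

text \<open>Whenever \<open>g\<close> misses an index \<open>f e\<close> with
  \<open>e \<in> X\<close>, moving \<open>e\<close> to that index keeps \<open>g\<close> a matching
  of \<open>Z\<close> and increases its agreement with \<open>f\<close> on \<open>X\<close>, so the
  process ends.\<close>

lemma matches_superset_covering:
  assumes "finite Z" "X \<subseteq> Z" "matches r A f X" "matches r A g Z"
  shows "\<exists>h. matches r A h Z \<and> f ` X \<subseteq> h ` Z"
  using assms(4)
proof (induction "card {e\<in>X. g e \<noteq> f e}" arbitrary: g rule: less_induct)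
  case less
  show ?case
  proof (cases "f ` X \<subseteq> g ` Z")
    case False
    then obtain e where e: "e \<in> X" "f e \<notin> g ` Z" by blast
    let ?g = "g(e := f e)"
    have "matches r A ?g (insert e Z)"
      using e assms(3) less.prems by (intro matches_insert) (auto simp: matches_def)
    moreover have "insert e Z = Z" using e(1) assms(2) by blast
    moreover have "card {a\<in>X. ?g a \<noteq> f a} < card {a\<in>X. g a \<noteq> f a}"
    proof (rule psubset_card_mono)
      show "finite {a\<in>X. g a \<noteq> f a}"
        using assms(1,2) finite_subset by fastforce
      have "g e \<noteq> f e" using e assms(2) by (metis imageI subsetD)
      then show "{a\<in>X. ?g a \<noteq> f a} \<subset> {a\<in>X. g a \<noteq> f a}" using e(1) by force
    qed
    ultimately show ?thesis using less.hyps[of ?g] by metis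
  qed (use less.prems in blast)
qed

lemma partial_transversal_insert_two_free:
  assumes "finite S" "matches r A g S" "partial_transversal r A (insert z S)"
    and "i \<in> {1..r}" "j \<in> {1..r}" "i \<noteq> j" "e \<in> A i" "e \<in> A j" "i \<notin> g ` S" "j \<notin> g ` S"
  shows "partial_transversal r A (insert e (insert z S))"
proof -
  obtain h where h: "matches r A h (insert z S)" "g ` S \<subseteq> h ` insert z S"
    using matches_superset_covering[of "insert z S" S r A g] assms(1-3)
    unfolding partial_transversal_iff_matches by blast
  \<comment> \<open>The image of \<open>S\<close> under \<open>g\<close> together with
    \<open>i\<close> and \<open>j\<close> has \<open>card S + 2\<close> indices, more than
    \<open>insert z S\<close> can occupy.\<close>
  have "\<not> (i \<in> h ` insert z S \<and> j \<in> h ` insert z S)"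
  proof
    assume "i \<in> h ` insert z S \<and> j \<in> h ` insert z S"
    with h(2) have "insert i (insert j (g ` S)) \<subseteq> h ` insert z S" by blast
    then have "card (insert i (insert j (g ` S))) \<le> card (h ` insert z S)"
      using assms(1) by (meson card_mono finite_imageI finite_insert)
    also have "\<dots> \<le> Suc (card S)"
      using card_image_le[of "insert z S" h] card_insert_if[of S z] assms(1) by (auto split: if_splits)
    also have "card S = card (g ` S)"
      using assms(2) by (simp add: matches_def card_image)
    finally show False using assms by simp
  qed
  then show ?thesis using partial_transversal_insert[OF h(1)] assms by blast
qed

section \<open>Coloops and enlarging one set of the system\<close>

text \<open>Only a matching that sends \<open>y\<close> to \<open>k\<close> is a problem. The rest
  of \<open>W\<close> then leaves \<open>k\<close> free, so \<open>y\<close> can be placed first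
  against the elements outside \<open>A k\<close>, and those of \<open>A k\<close> are put back one
  by one, \<open>k\<close> serving as their second free index.\<close>

lemma partial_transversal_enlarge_at_coloop:
  assumes "finite W" "k \<in> {1..r}" "y \<notin> A k"
    and W: "partial_transversal r (A(k := insert y (A k))) W"
    and coloop: "\<And>R. R \<subseteq> W \<Longrightarrow> y \<notin> R \<Longrightarrow> R \<inter> A k = {} \<Longrightarrow> partial_transversal r A R
                 \<Longrightarrow> partial_transversal r A (insert y R)"
  shows "partial_transversal r A W"
proof -
  obtain g where g: "matches r (A(k := insert y (A k))) g W"
    using W partial_transversal_iff_matches by blast
  show ?thesis
  proof (cases "y \<in> W \<and> g y = k")
    case False
    with g have "matches r A g W" by (auto simp: matches_def split: if_splits)
    then show ?thesis using partial_transversal_iff_matches by blast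
  next
    case True
    define C where "C = W - {y}"
    have k: "k \<notin> g ` C"
      using True g by (auto simp: matches_def C_def inj_on_def)
    have gC: "matches r A g C"
      using g k by (auto simp: matches_def C_def inj_on_def split: if_splits)
    \<comment> \<open>Removing \<open>A k\<close> from \<open>C\<close> makes the coloop hypothesis
      applicable.\<close>
    have base: "partial_transversal r A (insert y (C - A k))"
      using coloop[of "C - A k"] matches_subset[OF gC, of "C - A k"]
      unfolding partial_transversal_iff_matches C_def by blast
    have "finite (C \<inter> A k)" using assms(1) C_def by blast
    then have "partial_transversal r A (insert y ((C - A k) \<union> D))" if "D \<subseteq> C \<inter> A k" for D
      using that
    proof (induction D rule: infinite_finite_induct)
      case (infinite D)
      then show ?case using finite_subset by blast
    next
      case empty
      then show ?case using base by simp
    next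
      case (insert e D)
      let ?S = "(C - A k) \<union> D"
      have S: "insert e ?S \<subseteq> C" "e \<notin> ?S" "e \<in> C" "e \<in> A k" using insert by auto
      \<comment> \<open>The two indices for \<open>e\<close> are \<open>g e\<close> and
        \<open>k\<close>; \<open>g\<close> uses neither on \<open>?S\<close>.\<close>
      have "g e \<notin> g ` ?S"
        using S gC unfolding matches_def inj_on_def by blast
      moreover have "g e \<noteq> k" using k S by blast
      moreover have "finite ?S" using S assms(1) C_def by (meson finite_Diff finite_insert finite_subset)
      moreover have "matches r A g ?S" using gC S by (meson matches_subset subset_insertI subset_trans)
      moreover have "partial_transversal r A (Set.insert y ?S)" using insert by simp
      ultimately have "partial_transversal r A (Set.insert e (Set.insert y ?S))"
        using S k gC assms(2)
        by (intro partial_transversal_insert_two_free[where i = "g e" and j = k and g = g])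
           (auto simp: matches_def)
      then show ?case by (simp add: insert_commute)
    qed
    from this[of "C \<inter> A k"] have "partial_transversal r A (insert y C)"
      by (simp add: Un_Diff_Int)
    moreover have "insert y C = W" using True C_def by blast
    ultimately show ?thesis by simp
  qed
qed

text \<open>Were \<open>y\<close> not addable to \<open>R\<close>, some basis \<open>S\<close>
  containing \<open>R\<close> would avoid \<open>y\<close>. Exchanging \<open>y\<close> in
  \<open>T\<close> for some \<open>z \<in> S\<close> leaves two indices for \<open>y\<close>, so
  \<open>y\<close> can return alongside \<open>z\<close>, contradicting the maximality of
  \<open>T\<close>.\<close>

lemma partial_transversal_insert_coloop:
  assumes "finite E" "T \<subseteq> E" "y \<in> T"
    and max: "\<And>S. S \<subseteq> E \<Longrightarrow> partial_transversal r A S \<Longrightarrow> T \<subseteq> S \<Longrightarrow> S = T"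
    and T: "matches r A g T" "i \<in> {1..r}" "y \<in> A i" "i \<notin> g ` T"
    and R: "R \<subseteq> E" "partial_transversal r A R"
  shows "partial_transversal r A (insert y R)"
proof (rule ccontr)
  assume dep: "\<not> partial_transversal r A (insert y R)"
  define \<F> where "\<F> = {S. R \<subseteq> S \<and> S \<subseteq> E \<and> partial_transversal r A S}"
  have "finite \<F>" using assms(1) by (simp add: \<F>_def)
  moreover have "\<F> \<noteq> {}" using R by (auto simp: \<F>_def)
  ultimately obtain S where S: "S \<in> \<F>" and S_max: "\<And>S'. S' \<in> \<F> \<Longrightarrow> S \<subseteq> S' \<Longrightarrow> S = S'"
    using finite_has_maximal[of \<F>] by blast
  have fin: "finite S" "finite T" using S assms(1,2) finite_subset by (auto simp: \<F>_def)
  have y: "y \<notin> S"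
    using S dep partial_transversal_subset[of r A S "insert y R"] by (auto simp: \<F>_def)
  have T_pt: "partial_transversal r A T" using T(1) partial_transversal_iff_matches by blast
  \<comment> \<open>\<open>S\<close> is maximal among the independent sets containing
    \<open>R\<close>, so augmentation from \<open>T\<close> must fail.\<close>
  have "card T \<le> card S"
  proof (rule ccontr)
    assume "\<not> card T \<le> card S"
    then have "card S < card T" by simp
    then obtain z where z: "z \<in> T - S" "partial_transversal r A (insert z S)"
      using partial_transversal_insert_of_card_less[OF fin] S T_pt by (auto simp: \<F>_def)
    then have "insert z S \<in> \<F>" using S assms(2) by (auto simp: \<F>_def)
    with S_max z(1) show False by blast
  qed
  moreover have "card (T - {y}) < card T"
    using fin(2) \<open>y \<in> T\<close> by (rule card_Diff1_less)
  ultimately have "card (T - {y}) < card S" by simp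
  then obtain z where z: "z \<in> S - (T - {y})" "partial_transversal r A (insert z (T - {y}))"
    using partial_transversal_insert_of_card_less[of "T - {y}" S r A] fin S
      partial_transversal_subset[OF T_pt, of "T - {y}"] by (auto simp: \<F>_def)
  \<comment> \<open>On \<open>T - {y}\<close> both \<open>g y\<close> and \<open>i\<close> are free
    for \<open>y\<close>.\<close>
  have "partial_transversal r A (insert y (insert z (T - {y})))"
  proof (rule partial_transversal_insert_two_free[where i = i and j = "g y" and g = g])
    show "g y \<notin> g ` (T - {y})" using T(1) \<open>y \<in> T\<close> by (auto simp: matches_def inj_on_def)
    show "i \<noteq> g y" using T(4) \<open>y \<in> T\<close> by blast
  qed (use fin z T \<open>y \<in> T\<close> matches_subset[OF T(1), of "T - {y}"] in \<open>auto simp: matches_def\<close>)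
  moreover have "insert y (insert z (T - {y})) = insert z T" using \<open>y \<in> T\<close> by blast
  moreover have "z \<in> E" using z(1) S by (auto simp: \<F>_def)
  ultimately have "insert z T = T" using max[of "insert z T"] assms(2) by auto
  then show False using z(1) y by blast
qed

section \<open>Coloops of the extended systems\<close>

lemma coloop_ext_not_maximal:
  assumes "finite E" "set_system E r A" "x \<notin> E" "X \<subseteq> E" "k \<in> {1..r}" "k \<notin> supp r A X"
    and coloop: "coloop (deletion (matroid_of (insert x E) r (ext A x (supp r A X))) (A k)) x"
  shows "\<exists>y\<in>E - A k. matroid_of E r (A(k := insert y (A k))) = matroid_of E r A"
proof -
  let ?I = "supp r A X"
  let ?N = "deletion (matroid_of (insert x E) r (ext A x ?I)) (A k)"
  have AE: "A i \<subseteq> E" if "i \<in> {1..r}" for i using assms(2) that by (auto simp: set_system_def)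
  have xA: "x \<notin> A i" if "i \<in> {1..r}" for i using AE that assms(3) by blast
  have ext_iff: "partial_transversal r (ext A x ?I) S \<longleftrightarrow> partial_transversal r A S" if "S \<subseteq> E" for S
    using that assms(3) by (intro iffI; elim partial_transversal_mono) (auto simp: ext_def split: if_splits)
  have indeps_N: "S \<in> indeps ?N \<longleftrightarrow>
      S \<subseteq> insert x E \<and> partial_transversal r (ext A x ?I) S \<and> S \<inter> A k = {}" for S
    by (auto simp: deletion_def matroid_of_def)
  define \<F> where "\<F> = {S. S \<subseteq> E - A k \<and> partial_transversal r A S}"
  have "finite \<F>" using assms(1) by (simp add: \<F>_def)
  moreover have "{} \<in> \<F>" by (auto simp: \<F>_def partial_transversal_def)
  ultimately obtain T where T: "T \<in> \<F>" and T_max: "\<And>S. S \<in> \<F> \<Longrightarrow> T \<subseteq> S \<Longrightarrow> T = S"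
    using finite_has_maximal[of \<F>] by blast
  have "x \<notin> T" using T assms(3) by (auto simp: \<F>_def)
  \<comment> \<open>A coloop lies in every basis, so \<open>T\<close> extends properly in
    \<open>?N\<close>; since \<open>T\<close> is maximal inside \<open>E - A k\<close>, the
    extension must contain \<open>x\<close>.\<close>
  with coloop have "\<not> basis ?N T" by (auto simp: coloop_def)
  moreover have "T \<in> indeps ?N" using T ext_iff[of T] unfolding indeps_N by (auto simp: \<F>_def)
  ultimately obtain S where S: "S \<in> indeps ?N" "T \<subseteq> S" "S \<noteq> T" by (auto simp: basis_def)
  have "x \<in> S"
  proof (rule ccontr)
    assume "x \<notin> S"
    with S(1) have "S \<in> \<F>" using ext_iff[of S] unfolding indeps_N by (auto simp: \<F>_def)
    with T_max S show False by blast
  qed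
  obtain g where g: "matches r (ext A x ?I) g S"
    using S(1) unfolding indeps_N partial_transversal_iff_matches by blast
  have gT: "matches r A g T"
    using matches_subset[OF g S(2)]
    by (rule matches_mono) (use \<open>x \<notin> T\<close> in \<open>auto simp: ext_def split: if_splits\<close>)
  have i: "g x \<in> {1..r}" using g \<open>x \<in> S\<close> by (auto simp: matches_def)
  have free: "g x \<notin> g ` T"
    using g \<open>x \<in> S\<close> \<open>x \<notin> T\<close> S(2) unfolding matches_def inj_on_def by blast
  have "x \<in> ext A x ?I (g x)" using g \<open>x \<in> S\<close> by (auto simp: matches_def)
  with xA[OF i] have "g x \<in> ?I" by (auto simp: ext_def split: if_splits)
  then obtain y where y: "y \<in> X" "y \<in> A (g x)" by (auto simp: supp_def)
  have yk: "y \<in> E - A k" using y(1) assms(4-6) by (auto simp: supp_def)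
  \<comment> \<open>The index \<open>g x\<close>, vacated by dropping \<open>x\<close>, can host
    \<open>y\<close>; maximality of \<open>T\<close> then forces \<open>y \<in> T\<close>.\<close>
  have "insert y T \<in> \<F>"
    using partial_transversal_insert[OF gT i y(2) free] T yk by (auto simp: \<F>_def)
  with T_max have "y \<in> T" by blast
  have y_coloop: "partial_transversal r A (insert y R)"
    if "R \<subseteq> E - A k" "partial_transversal r A R" for R
    using assms(1) T T_max \<open>y \<in> T\<close>
    by (intro partial_transversal_insert_coloop[OF _ _ _ _ gT i y(2) free that]) (auto simp: \<F>_def)
  have "partial_transversal r (A(k := insert y (A k))) W \<longleftrightarrow> partial_transversal r A W"
    if "W \<subseteq> E" for W
  proof
    assume "partial_transversal r (A(k := insert y (A k))) W"
    then show "partial_transversal r A W"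
    proof (rule partial_transversal_enlarge_at_coloop[rotated 3])
      show "finite W" using that assms(1) by (rule finite_subset)
      show "partial_transversal r A (insert y R)"
        if "R \<subseteq> W" "R \<inter> A k = {}" "partial_transversal r A R" for R
        using that \<open>W \<subseteq> E\<close> by (intro y_coloop) auto
    qed (use assms(5) yk in auto)
  qed (elim partial_transversal_mono, auto)
  then have "matroid_of E r (A(k := insert y (A k))) = matroid_of E r A"
    by (auto simp: matroid_of_def)
  then show ?thesis using yk by blast
qed

lemma coloop_ext_of_smaller_presentation:
  assumes "x \<notin> E" "set_system E r B" and same: "matroid_of E r A = matroid_of E r B"
    and "pres_le r A B" "X \<subseteq> E" "k \<in> supp r B X"
  shows "coloop (deletion (matroid_of (insert x E) r (ext B x (supp r A X))) (B k)) x"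
proof -
  let ?I = "supp r A X"
  let ?N = "deletion (matroid_of (insert x E) r (ext B x ?I)) (B k)"
  obtain y where y: "k \<in> {1..r}" "y \<in> X" "y \<in> B k" using assms(6) by (auto simp: supp_def)
  have xB: "x \<notin> B k" using y(1) assms(1,2) by (auto simp: set_system_def)
  have same': "partial_transversal r A S \<longleftrightarrow> partial_transversal r B S" if "S \<subseteq> E" for S
    using same that unfolding matroid_of_def pre_matroid.ext_inject set_eq_iff mem_Collect_eq by blast
  have "x \<in> T" if "basis ?N T" for T
  proof (rule ccontr)
    assume "x \<notin> T"
    have T: "T \<subseteq> insert x E" "partial_transversal r (ext B x ?I) T" "T \<inter> B k = {}"
      using that by (auto simp: basis_def deletion_def matroid_of_def)
    with \<open>x \<notin> T\<close> have "T \<subseteq> E" by blast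
    have "partial_transversal r B T"
      using T(2) by (rule partial_transversal_mono) (use \<open>x \<notin> T\<close> in \<open>auto simp: ext_def split: if_splits\<close>)
    then obtain f where f: "matches r B f T" using partial_transversal_iff_matches by blast
    have "k \<notin> f ` T" using f T(3) by (auto simp: matches_def)
    \<comment> \<open>The index \<open>k\<close> is available in \<open>B\<close>; equality of the
      two matroids carries independence back to \<open>A\<close>.\<close>
    then have "partial_transversal r A (insert y T)"
      using partial_transversal_insert[OF f y(1,3)] same'[of "insert y T"] \<open>T \<subseteq> E\<close> y(2) assms(5) by auto
    then obtain h where h: "matches r A h (insert y T)" using partial_transversal_iff_matches by blast
    have "y \<notin> T" using T(3) y(3) by blast
    have hy: "h y \<in> {1..r}" "y \<in> A (h y)" "h y \<notin> h ` T"
      using h \<open>y \<notin> T\<close> by (auto simp: matches_def)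
    then have "h y \<in> ?I" using y(2) by (auto simp: supp_def)
    then have "x \<in> ext B x ?I (h y)" by (simp add: ext_def)
    \<comment> \<open>As \<open>A\<close> lies below \<open>B\<close>, \<open>h\<close> still
      matches \<open>T\<close> here and leaves \<open>h y\<close> to \<open>x\<close>.\<close>
    moreover have "matches r (ext B x ?I) h T"
      using matches_subset[OF h subset_insertI]
      by (rule matches_mono) (use assms(4) in \<open>auto simp: ext_def pres_le_def\<close>)
    ultimately have "partial_transversal r (ext B x ?I) (insert x T)"
      by (intro partial_transversal_insert[OF _ hy(1) _ hy(3)])
    then have "insert x T \<in> indeps ?N"
      using T xB by (auto simp: deletion_def matroid_of_def)
    with that \<open>x \<notin> T\<close> show False by (auto simp: basis_def)
  qed
  moreover have "x \<in> ground ?N" using xB by (simp add: deletion_def matroid_of_def)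
  ultimately show ?thesis by (simp add: coloop_def)
qed

theorem theorem3p10:
  fixes M :: "'a pre_matroid" and E :: "'a set" and r :: nat
    and A B :: "nat \<Rightarrow> 'a set" and x :: 'a
  assumes "transversal_matroid M" and "ground M = E" and "rank M = r"
    and "presentation M A" and "presentation M B"
    and "x \<notin> E"
  shows "(maximal_presentation M A \<longrightarrow> (\<forall>X. X \<subseteq> E \<longrightarrow> supp r A X \<in> L E r x A)) \<and>
         (pres_less r A B \<longrightarrow>
            (\<forall>X. X \<subseteq> E \<longrightarrow> supp r A X \<noteq> supp r B X \<longrightarrow> supp r A X \<notin> L E r x B))"
proof (intro conjI impI allI)
  fix X assume max: "maximal_presentation M A" and "X \<subseteq> E"
  have A: "set_system E r A" "matroid_of E r A = M" using assms by (auto simp: presentation_def)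
  have "finite E" using assms(1,2) by (auto simp: transversal_matroid_def is_matroid_def)
  \<comment> \<open>Membership in \<open>L\<close> says that \<open>sigma\<close> adds no index
    outside the support.\<close>
  have "\<not> coloop (deletion (matroid_of (insert x E) r (ext A x (supp r A X))) (A k)) x"
    if k: "k \<in> {1..r} - supp r A X" for k
  proof
    assume "coloop (deletion (matroid_of (insert x E) r (ext A x (supp r A X))) (A k)) x"
    then obtain y where y: "y \<in> E - A k" "matroid_of E r (A(k := insert y (A k))) = M"
      using coloop_ext_not_maximal[OF \<open>finite E\<close> A(1) assms(6) \<open>X \<subseteq> E\<close>] k A(2) by blast
    have "presentation M (A(k := insert y (A k)))"
      using y A(1) assms(2,3) by (auto simp: presentation_def set_system_def)
    moreover have "pres_less r A (A(k := insert y (A k)))"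
      using y(1) k by (auto simp: pres_less_def pres_le_def)
    ultimately show False using max assms(3) by (auto simp: maximal_presentation_def)
  qed
  then show "supp r A X \<in> L E r x A" by (auto simp: L_def sigma_def supp_def)
next
  fix X assume less: "pres_less r A B" and "X \<subseteq> E" and neq: "supp r A X \<noteq> supp r B X"
  have le: "pres_le r A B" using less by (simp add: pres_less_def)
  then have "supp r A X \<subseteq> supp r B X" by (fastforce simp: supp_def pres_le_def)
  with neq obtain k where k: "k \<in> supp r B X" "k \<notin> supp r A X" by blast
  have "coloop (deletion (matroid_of (insert x E) r (ext B x (supp r A X))) (B k)) x"
    using assms by (intro coloop_ext_of_smaller_presentation[OF _ _ _ le \<open>X \<subseteq> E\<close> k(1)])
      (auto simp: presentation_def)
  moreover have "k \<in> {1..r}" using k(1) by (simp add: supp_def)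
  ultimately have "k \<in> sigma E r x B (supp r A X)" using k(2) by (simp add: sigma_def)
  with k(2) show "supp r A X \<notin> L E r x B" by (auto simp: L_def)
qed

end
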